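(* Let $N\ge 2$, $p\in[1,\infty)$ and $q,r\in[1,\infty]$. Then the homogeneous Strichartz estimate for the Schrödinger equation in $\mathbb{H}^N$, $$ \begin{cases} i\partial_t\psi-\Delta_{\mathbb{H}^N}\psi=0\quad\text{in }\mathbb{H}^N,\qquad \psi(0)=\psi_0,\\ \|\psi\|_{L^p(\mathbb{R};L^q(\mathbb{H}^N))}\le C\,\|\psi_0\|_{L^r(\mathbb{H}^N)}, \end{cases} $$ can only hold provided $1\le r\le 2$.
   Context: $\mathbb{H}^N$ is the $N$-dimensional hyperbolic space (constant curvature $-1$) with its Riemannian volume measure, and $\Delta_{\mathbb{H}^N}$ is its Laplace-Beltrami operator. The norm is $\|\psi\|_{L^p(\mathbb{R};L^q(\mathbb{H}^N))}=\left(\int_{\mathbb{R}}\|\psi(t)\|_{L^q(\mathbb{H}^N)}^p\,dt\right)^{1/p}$. The Strichartz estimate is the assertion that the displayed inequality holds for solutions $\psi$ of the displayed initial value problem with initial datum $\psi_0$, with a constant $C>0$ independent of $\psi_0$. *)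

theory Defs
  imports "HOL-Analysis.Analysis" "HOL-Probability.Essential_Supremum"
begin

section \<open>Lebesgue norms with values in \<open>[0, \<infinity>]\<close>\<close>

text \<open>Only used with \<open>a > 0\<close>.\<close>

definition epowr :: "ennreal \<Rightarrow> real \<Rightarrow> ennreal" where
  "epowr x a = (if x = \<infinity> then \<infinity> else ennreal (enn2real x powr a))"

definition Lp_norm :: "'a measure \<Rightarrow> ennreal \<Rightarrow> ('a \<Rightarrow> complex) \<Rightarrow> ennreal" where
  "Lp_norm M q f =
     (if q = \<infinity> then esssup M (\<lambda>x. ennreal (norm (f x)))
      else epowr (\<integral>\<^sup>+ x. ennreal (norm (f x) powr enn2real q) \<partial>M) (1 / enn2real q))"

definition in_Lp :: "'a measure \<Rightarrow> ennreal \<Rightarrow> ('a \<Rightarrow> complex) \<Rightarrow> bool" where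
  "in_Lp M q f \<longleftrightarrow> f \<in> borel_measurable M \<and> Lp_norm M q f < \<infinity>"

definition mixed_norm ::
    "real \<Rightarrow> ennreal \<Rightarrow> 'a measure \<Rightarrow> (real \<Rightarrow> 'a \<Rightarrow> complex) \<Rightarrow> ennreal" where
  "mixed_norm p q M \<psi> = epowr (\<integral>\<^sup>+ t. epowr (Lp_norm M q (\<psi> t)) p \<partial>lborel) (1 / p)"


section \<open>Functions of class \<open>C\<^sup>2\<close>\<close>

definition partial :: "'n::finite \<Rightarrow> (real^'n \<Rightarrow> complex) \<Rightarrow> real^'n \<Rightarrow> complex" where
  "partial i f x = frechet_derivative f (at x) (axis i 1)"

text \<open>The set \<open>S\<close> is meant to be open.\<close>

definition C1_on :: "(real^'n::finite) set \<Rightarrow> (real^'n \<Rightarrow> complex) \<Rightarrow> bool" where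
  "C1_on S f \<longleftrightarrow> f differentiable_on S \<and> (\<forall>i. continuous_on S (partial i f))"

definition C2_on :: "(real^'n::finite) set \<Rightarrow> (real^'n \<Rightarrow> complex) \<Rightarrow> bool" where
  "C2_on S f \<longleftrightarrow> C1_on S f \<and> (\<forall>i. C1_on S (partial i f))"


section \<open>Riemannian volume and Laplace--Beltrami operator in a global chart\<close>

text \<open>
  A Riemannian metric on an open subset of \<open>\<real>\<^sup>n\<close> is given by its Gram matrices \<open>g x\<close>.
  The operator is \<open>\<Delta>\<^sub>g u = (det g)\<^bsup>-1/2\<^esup> \<Sum>\<^sub>i \<partial>\<^sub>i ((det g)\<^bsup>1/2\<^esup> \<Sum>\<^sub>j g\<^bsup>ij\<^esup> \<partial>\<^sub>j u)\<close>.
\<close>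

definition volume_density :: "(real^'n \<Rightarrow> real^'n^'n) \<Rightarrow> real^'n::finite \<Rightarrow> real" where
  "volume_density g x = sqrt (det (g x))"

definition riemannian_volume ::
    "(real^'n::finite) set \<Rightarrow> (real^'n \<Rightarrow> real^'n^'n) \<Rightarrow> (real^'n) measure" where
  "riemannian_volume S g =
     density (restrict_space lborel S) (\<lambda>x. ennreal (volume_density g x))"

definition laplace_beltrami ::
    "(real^'n \<Rightarrow> real^'n^'n) \<Rightarrow> (real^'n::finite \<Rightarrow> complex) \<Rightarrow> real^'n \<Rightarrow> complex" where
  "laplace_beltrami g u x =
     (1 / volume_density g x) *\<^sub>R
       (\<Sum>i\<in>UNIV. partial i
          (\<lambda>y. volume_density g y *\<^sub>R
             (\<Sum>j\<in>UNIV. (matrix_inv (g y) $ i $ j) *\<^sub>R partial j u y)) x)"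


section \<open>Hyperbolic space (Poincare ball model, curvature \<open>-1\<close>)\<close>

text \<open>
  Hyperbolic space of dimension \<open>CARD('n)\<close> is the open unit ball with the metric
  \<open>4 |dx|\<^sup>2 / (1 - |x|\<^sup>2)\<^sup>2\<close>. Functions on it are total functions on \<open>real^'n\<close> whose values
  outside the ball are irrelevant to everything below.
\<close>

definition hyp_space :: "(real^'n::finite) set" where
  "hyp_space = ball 0 1"

definition hyp_metric :: "real^'n::finite \<Rightarrow> real^'n^'n" where
  "hyp_metric x = (4 / (1 - (norm x)\<^sup>2)\<^sup>2) *\<^sub>R mat 1"

definition hyp_volume :: "(real^'n::finite) measure" where
  "hyp_volume = riemannian_volume hyp_space hyp_metric"

abbreviation hyp_laplacian :: "(real^'n::finite \<Rightarrow> complex) \<Rightarrow> real^'n \<Rightarrow> complex" where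
  "hyp_laplacian \<equiv> laplace_beltrami hyp_metric"


section \<open>The Schroedinger equation\<close>

definition classical_schroedinger_solution :: "(real \<Rightarrow> real^'n::finite \<Rightarrow> complex) \<Rightarrow> bool" where
  "classical_schroedinger_solution \<psi> \<longleftrightarrow>
     (\<forall>t. C2_on hyp_space (\<psi> t)) \<and>
     (\<forall>x\<in>hyp_space. (\<lambda>t. \<psi> t x) differentiable_on UNIV) \<and>
     continuous_on (UNIV \<times> hyp_space) (\<lambda>(t, x). vector_derivative (\<lambda>s. \<psi> s x) (at t)) \<and>
     (\<forall>t. \<forall>x\<in>hyp_space.
        \<i> * vector_derivative (\<lambda>s. \<psi> s x) (at t) - hyp_laplacian (\<psi> t) x = 0)"

definition continuous_in_Lp :: "'a measure \<Rightarrow> ennreal \<Rightarrow> (real \<Rightarrow> 'a \<Rightarrow> complex) \<Rightarrow> bool" where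
  "continuous_in_Lp M r \<psi> \<longleftrightarrow>
     (\<forall>t. in_Lp M r (\<psi> t)) \<and>
     (\<forall>t. ((\<lambda>s. Lp_norm M r (\<lambda>x. \<psi> s x - \<psi> t x)) \<longlongrightarrow> 0) (at t))"

text \<open>
  Solutions of the initial value problem with datum in \<open>L\<^sup>r\<close>. Membership in \<open>C(\<real>; L\<^sup>r)\<close> excludes
  rapidly growing solutions that start from \<open>0\<close> (Tychonoff phenomenon); without it an estimate
  quantified over all classical solutions could fail for reasons unrelated to the exponents.
\<close>

definition schroedinger_ivp_solution ::
    "ennreal \<Rightarrow> (real^'n::finite \<Rightarrow> complex) \<Rightarrow> (real \<Rightarrow> real^'n \<Rightarrow> complex) \<Rightarrow> bool" where
  "schroedinger_ivp_solution r \<psi>\<^sub>0 \<psi> \<longleftrightarrow>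
     classical_schroedinger_solution \<psi> \<and>
     continuous_in_Lp hyp_volume r \<psi> \<and>
     (\<forall>x\<in>hyp_space. \<psi> 0 x = \<psi>\<^sub>0 x)"

text \<open>The type argument fixes the dimension \<open>N = CARD('n)\<close>.\<close>

definition strichartz_estimate :: "'n::finite itself \<Rightarrow> real \<Rightarrow> ennreal \<Rightarrow> ennreal \<Rightarrow> bool" where
  "strichartz_estimate _ p q r \<longleftrightarrow>
     (\<exists>C::real. C > 0 \<and>
        (\<forall>(\<psi>\<^sub>0 :: real^'n \<Rightarrow> complex) \<psi>.
           in_Lp hyp_volume r \<psi>\<^sub>0 \<longrightarrow> schroedinger_ivp_solution r \<psi>\<^sub>0 \<psi> \<longrightarrow>
           mixed_norm p q hyp_volume \<psi> \<le> ennreal C * Lp_norm hyp_volume r \<psi>\<^sub>0))"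

end

theory Submission
  imports Defs
begin

text \<open>
  For \<open>r > 2\<close> the estimate is refuted by a standing wave. Suppose that \<open>u\<close> is a nonzero function in
  \<open>L\<^sup>r\<close> with \<open>\<Delta> u = - a u\<close> for a real number \<open>a\<close>. Then \<open>\<psi>(t) = exp (\<i> a t) u\<close> is a solution
  that is continuous with values in \<open>L\<^sup>r\<close>
  (\<open>classical_solution_standing_wave\<close>, \<open>continuous_in_Lp_standing_wave\<close>), and its
  \<open>L\<^sup>q\<close> norm is the same positive number, possibly infinite, at all times. As \<open>p\<close> is finite, the
  left-hand side of the estimate is infinite (\<open>mixed_norm_standing_wave\<close>) while the right-hand side
  is finite.

  It remains to find such a \<open>u\<close>. A radial eigenfunction that decays like \<open>(1 - \<bar>x\<bar>\<^sup>2)\<^sup>s\<close> at the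
  boundary of the ball has the eigenvalue \<open>- s (N - 1 - s)\<close>. The hyperbolic volume has the density
  \<open>(2 / (1 - \<bar>x\<bar>\<^sup>2))\<^sup>N\<close>, so such a function is in \<open>L\<^sup>r\<close> as soon as \<open>s r > N - 1\<close>,
  which for \<open>r = \<infinity>\<close> means \<open>s > 0\<close> (\<open>in_Lp_hyp_volume\<close>). For \<open>r > 2\<close> there is room for an \<open>s\<close> with \<open>(N - 1) / r < s < (N - 1) / 2\<close>.
  For \<open>N / 2 - 1 < s < (N - 1) / 2\<close> the eigenfunction that is regular at the centre is
  \<open>u(x) = (1 - z)\<^sup>s F(z)\<close> with \<open>z = \<bar>x\<bar>\<^sup>2\<close>, where \<open>F\<close> is Gauss's hypergeometric series with parameters
  \<open>s\<close>, \<open>s + 1 - N / 2\<close>, \<open>N / 2\<close>. These parameters are positive, so that \<open>F\<close> is positive,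
  and the third exceeds the sum of the first two by \<open>N - 1 - 2 s > 0\<close>, so that \<open>F\<close> is bounded on
  \<open>[0, 1)\<close> (\<open>radial_eigenprofile\<close>). That \<open>u\<close> is an eigenfunction follows from the expression of the
  Laplacian on radial functions (\<open>hyp_laplacian_radial\<close>).
\<close>

section \<open>The hypergeometric series and the radial eigenvalue equation\<close>

definition hypergeom_coeff :: "real \<Rightarrow> real \<Rightarrow> real \<Rightarrow> nat \<Rightarrow> real" where
  "hypergeom_coeff a b c k = pochhammer a k * pochhammer b k / (pochhammer c k * fact k)"

lemma hypergeom_coeff_pos:
  assumes "a > 0" "b > 0" "c > 0"
  shows "hypergeom_coeff a b c k > 0"
  using assms by (simp add: hypergeom_coeff_def pochhammer_pos)

lemma hypergeom_coeff_Suc: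
  assumes "c > 0"
  shows "(real k + 1) * (c + real k) * hypergeom_coeff a b c (Suc k)
         = (a + real k) * (b + real k) * hypergeom_coeff a b c k"
proof -
  have "pochhammer c k > 0" "c + real k > 0" using assms by (simp_all add: pochhammer_pos add_pos_nonneg)
  then show ?thesis
    by (simp add: hypergeom_coeff_def pochhammer_Suc divide_simps)
qed

text \<open>
  Raabe's test: the ratio of consecutive coefficients is \<open>1 + (c + 1 - a - b) / k + O(1 / k\<^sup>2)\<close>, and
  \<open>c + 1 - a - b > 1\<close>. So the hypergeometric series converges up to and including \<open>z = 1\<close>, which
  is what bounds its sum on \<open>[0, 1)\<close>.
\<close>
lemma hypergeom_coeff_summable:
  assumes "a > 0" "b > 0" "c > 0" "a + b < c"
  shows "summable (hypergeom_coeff a b c)"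
proof (rule raabes_test_convergence)
  let ?h = "hypergeom_coeff a b c"
  show "\<forall>\<^sub>F n in sequentially. 0 < ?h n"
    using hypergeom_coeff_pos[OF assms(1-3)] by simp
  have ratio: "?h n / ?h (Suc n) = (real n + 1) * (c + real n) / ((a + real n) * (b + real n))" for n
  proof -
    have "?h (Suc n) > 0" "a + real n > 0" "b + real n > 0"
      using hypergeom_coeff_pos[OF assms(1-3)] assms by (simp_all add: add_pos_nonneg)
    then show ?thesis using hypergeom_coeff_Suc[OF assms(3), of n a b]
      by (simp add: frac_eq_eq mult.commute)
  qed
  have eq: "(\<lambda>n. real n * (?h n / ?h (Suc n) - 1)) =
     (\<lambda>n. real n * (((real n + 1) * (c + real n)) / ((a + real n) * (b + real n)) - 1))"
    by (simp add: ratio)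
  have "(\<lambda>n. real n * (((real n + 1) * (c + real n)) / ((a + real n) * (b + real n)) - 1))
     \<longlonglongrightarrow> c + 1 - a - b"
  proof -
    have 1: "real n * (((real n + 1) * (c + real n)) / ((a + real n) * (b + real n)) - 1)
       = ((c + 1 - a - b) + (c - a * b) / real n) / ((a / real n + 1) * (b / real n + 1))"
      if "n > 0" for n
    proof -
      have "a + real n > 0" "b + real n > 0" using assms by (simp_all add: add_pos_nonneg)
      then show ?thesis using that by (simp add: divide_simps) (simp add: algebra_simps)
    qed
    have "(\<lambda>n. ((c + 1 - a - b) + (c - a * b) / real n) / ((a / real n + 1) * (b / real n + 1)))
       \<longlonglongrightarrow> ((c + 1 - a - b) + 0) / ((0 + 1) * (0 + 1))"
      by (intro tendsto_intros lim_const_over_n) simp_all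
    moreover have "\<forall>\<^sub>F n in sequentially. real n * (((real n + 1) * (c + real n)) / ((a + real n) * (b + real n)) - 1)
       = ((c + 1 - a - b) + (c - a * b) / real n) / ((a / real n + 1) * (b / real n + 1))"
      using eventually_gt_at_top[of 0] by eventually_elim (rule 1)
    ultimately show ?thesis by (simp add: tendsto_cong)
  qed
  then have "(\<lambda>n. ereal (real n * (?h n / ?h (Suc n) - 1))) \<longlonglongrightarrow> ereal (c + 1 - a - b)"
    by (simp only: eq tendsto_ereal)
  then have "liminf (\<lambda>n. ereal (real n * (?h n / ?h (Suc n) - 1))) = ereal (c + 1 - a - b)"
    by (intro lim_imp_Liminf) simp_all
  then show "1 < liminf (\<lambda>n. ereal (real n * (?h n / ?h (Suc n) - 1)))"
    using assms(4) by simp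
qed

text \<open>
  Gauss's differential equation for \<open>G(z) = F(a, b; c; z)\<close>. Comparing the coefficients of \<open>z\<^sup>k\<close> in
  \<open>z G'' + c G'\<close> and in \<open>z\<^sup>2 G'' + (a + b + 1) z G' + a b G\<close> gives the two sides of
  the recurrence \<open>hypergeom_coeff_Suc\<close>. As all coefficients are positive, \<open>G\<close> lies between
  \<open>0\<close> and the sum of its coefficients on \<open>[0, 1)\<close>.
\<close>
lemma hypergeom_equation:
  assumes "a > 0" "b > 0" "c > 0" "a + b < c"
  shows "\<exists>(G :: real \<Rightarrow> real) G1 G2 B.
    (\<forall>z. \<bar>z\<bar> < 1 \<longrightarrow> (G has_real_derivative G1 z) (at z) \<and> (G1 has_real_derivative G2 z) (at z) \<and>
       isCont G2 z \<and> z * (1 - z) * G2 z + (c - (a + b + 1) * z) * G1 z - a * b * G z = 0) \<and>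
    (\<forall>z. 0 \<le> z \<and> z < 1 \<longrightarrow> 0 < G z \<and> G z \<le> B)"
proof -
  define h where "h = hypergeom_coeff a b c"
  define S where "S = (\<lambda>(d::nat \<Rightarrow> real) z. \<Sum>n. d n * z ^ n)"
  have pos: "h n > 0" for n
    unfolding h_def by (rule hypergeom_coeff_pos[OF assms(1-3)])
  have sh: "summable h" unfolding h_def by (rule hypergeom_coeff_summable[OF assms])
  have s0: "summable (\<lambda>n. h n * z ^ n)" if "norm z < 1" for z :: real
  proof (rule summable_comparison_test[OF _ sh], intro exI allI impI)
    fix n
    have "\<bar>z\<bar> ^ n \<le> 1" using that by (intro power_le_one) auto
    then show "norm (h n * z ^ n) \<le> h n"
      using pos[of n] by (simp add: abs_mult power_abs mult_left_le)
  qed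
  have s1: "summable (\<lambda>n. diffs h n * z ^ n)" if "norm z < 1" for z :: real
    using termdiff_converges[OF that s0] .
  have s2: "summable (\<lambda>n. diffs (diffs h) n * z ^ n)" if "norm z < 1" for z :: real
    using termdiff_converges[OF that s1] .
  have d0: "(S h has_real_derivative S (diffs h) z) (at z)" if "norm z < 1" for z
    unfolding S_def using s0 that by (rule termdiffs_strong')
  have d1: "(S (diffs h) has_real_derivative S (diffs (diffs h)) z) (at z)" if "norm z < 1" for z
    unfolding S_def using s1 that by (rule termdiffs_strong')
  have d2: "(S (diffs (diffs h)) has_real_derivative S (diffs (diffs (diffs h))) z) (at z)" if "norm z < 1" for z
    unfolding S_def using s2 that by (rule termdiffs_strong')
  have ode: "z * (1 - z) * S (diffs (diffs h)) z + (c - (a + b + 1) * z) * S (diffs h) z - a * b * S h z = 0"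
    if z: "\<bar>z\<bar> < 1" for z
  proof -
    have nz: "norm z < 1" using z by simp
    have S0: "(\<lambda>n. h n * z ^ n) sums S h z"
      unfolding S_def by (rule summable_sums[OF s0[OF nz]])
    have S1: "(\<lambda>n. diffs h n * z ^ n) sums S (diffs h) z"
      unfolding S_def by (rule summable_sums[OF s1[OF nz]])
    have S2: "(\<lambda>n. diffs (diffs h) n * z ^ n) sums S (diffs (diffs h)) z"
      unfolding S_def by (rule summable_sums[OF s2[OF nz]])
    \<comment> \<open>\<open>z G'\<close>, \<open>z G''\<close> and \<open>z\<^sup>2 G''\<close> as power series in the same power of \<open>z\<close>; each index shift
      is free because the new term of order \<open>0\<close> vanishes.\<close>
    have T1: "(\<lambda>n. real n * h n * z ^ n) sums (z * S (diffs h) z)"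
    proof -
      have "(\<lambda>n. real (Suc n) * h (Suc n) * z ^ Suc n) sums (z * S (diffs h) z)"
        using sums_mult[OF S1, of z] by (simp add: diffs_def algebra_simps)
      then show ?thesis by (subst (asm) sums_Suc_iff) simp
    qed
    have T2: "(\<lambda>n. real (n + 1) * real n * h (n + 1) * z ^ n) sums (z * S (diffs (diffs h)) z)"
    proof -
      have "(\<lambda>n. real (Suc n + 1) * real (Suc n) * h (Suc n + 1) * z ^ Suc n) sums (z * S (diffs (diffs h)) z)"
        using sums_mult[OF S2, of z] by (simp add: diffs_def algebra_simps)
      then show ?thesis by (subst (asm) sums_Suc_iff) simp
    qed
    have T3: "(\<lambda>n. real n * (real n - 1) * h n * z ^ n) sums (z * (z * S (diffs (diffs h)) z))"
    proof -
      have "(\<lambda>n. real (Suc n) * (real (Suc n) - 1) * h (Suc n) * z ^ Suc n) sums (z * (z * S (diffs (diffs h)) z))"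
        using sums_mult[OF T2, of z] by (simp add: algebra_simps)
      then show ?thesis by (subst (asm) sums_Suc_iff) simp
    qed
    have L: "(\<lambda>n. (real (n + 1) * real n * h (n + 1) * z ^ n) + c * (diffs h n * z ^ n))
        sums (z * S (diffs (diffs h)) z + c * S (diffs h) z)"
      by (intro sums_add sums_mult T2 S1)
    have R: "(\<lambda>n. real n * (real n - 1) * h n * z ^ n + (a + b + 1) * (real n * h n * z ^ n) + (a * b) * (h n * z ^ n))
        sums (z * (z * S (diffs (diffs h)) z) + (a + b + 1) * (z * S (diffs h) z) + (a * b) * S h z)"
      by (intro sums_add sums_mult T3 T1 S0)
    have "(real (n + 1) * real n * h (n + 1) * z ^ n) + c * (diffs h n * z ^ n) =
       real n * (real n - 1) * h n * z ^ n + (a + b + 1) * (real n * h n * z ^ n) + (a * b) * (h n * z ^ n)" for n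
    proof -
      have "(real (n + 1) * real n * h (n + 1) * z ^ n) + c * (diffs h n * z ^ n)
         = ((real n + 1) * (c + real n) * h (Suc n)) * z ^ n"
        by (simp add: diffs_def algebra_simps)
      also have "\<dots> = ((a + real n) * (b + real n) * h n) * z ^ n"
        using hypergeom_coeff_Suc[OF assms(3), of n a b] by (simp add: h_def)
      also have "\<dots> = real n * (real n - 1) * h n * z ^ n + (a + b + 1) * (real n * h n * z ^ n) + (a * b) * (h n * z ^ n)"
        by (simp add: algebra_simps)
      finally show ?thesis .
    qed
    then have "z * S (diffs (diffs h)) z + c * S (diffs h) z =
        z * (z * S (diffs (diffs h)) z) + (a + b + 1) * (z * S (diffs h) z) + (a * b) * S h z"
      using L R by (simp add: sums_unique2)
    then show ?thesis by (simp add: algebra_simps)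
  qed
  have bnd: "0 < S h z \<and> S h z \<le> suminf h" if "0 \<le> z" "z < 1" for z
  proof -
    have nz: "norm z < 1" using that by simp
    have "S h z > 0" unfolding S_def
      by (rule suminf_pos2[OF s0[OF nz], of 0]) (use pos that in \<open>auto simp: less_imp_le\<close>)
    moreover have "S h z \<le> suminf h" unfolding S_def
    proof (rule suminf_le[OF _ s0[OF nz] sh])
      show "h n * z ^ n \<le> h n" for n
        using pos[of n] that by (simp add: mult_left_le power_le_one)
    qed
    ultimately show ?thesis by simp
  qed
  show ?thesis
    by (intro exI[of _ "S h"] exI[of _ "S (diffs h)"] exI[of _ "S (diffs (diffs h))"] exI[of _ "suminf h"])
      (use d0 d1 DERIV_isCont[OF d2] ode bnd in auto)
qed

text \<open>
  Written in the variable \<open>z = \<bar>x\<bar>\<^sup>2\<close>, the equation \<open>\<Delta> u = - s (N - 1 - s) u\<close> for a radial function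
  \<open>u\<close> on \<open>N\<close>-dimensional hyperbolic space is the differential equation below. It has regular singular
  points at \<open>0\<close> and \<open>1\<close>, with exponents \<open>s\<close> and \<open>N - 1 - s\<close> at \<open>1\<close>. Splitting off \<open>(1 - z)\<^sup>s\<close> leaves
  the hypergeometric equation with parameters \<open>s\<close>, \<open>s + 1 - N / 2\<close>, \<open>N / 2\<close>. The lower bounds
  on \<open>s\<close> make these positive, and the upper bound says that the sum of the first two is less than
  the third, so that the remaining factor is bounded.
\<close>
lemma radial_eigenprofile:
  fixes N s :: real
  assumes "N / 2 - 1 < s" "0 < s" "s < (N - 1) / 2" "0 < N"
  shows "\<exists>(f :: real \<Rightarrow> real) f1 f2 B.
    (\<forall>z. \<bar>z\<bar> < 1 \<longrightarrow> (f has_real_derivative f1 z) (at z) \<and> (f1 has_real_derivative f2 z) (at z) \<and>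
       isCont f2 z \<and>
       (1 - z)\<^sup>2 * z * f2 z + ((1 - z)\<^sup>2 * N / 2 + (N - 2) * z * (1 - z)) * f1 z
        = - (s * (N - 1 - s)) * f z) \<and>
    (\<forall>z. 0 \<le> z \<and> z < 1 \<longrightarrow> 0 < f z \<and> f z \<le> B * (1 - z) powr s)"
proof -
  define a b c where "a = s" and "b = s + 1 - N / 2" and "c = N / 2"
  have abc: "a > 0" "b > 0" "c > 0" "a + b < c"
    using assms by (auto simp: a_def b_def c_def field_simps)
  obtain G G1 G2 :: "real \<Rightarrow> real" and B where
    G0: "\<forall>z. \<bar>z\<bar> < 1 \<longrightarrow> (G has_real_derivative G1 z) (at z) \<and> (G1 has_real_derivative G2 z) (at z) \<and>
       isCont G2 z \<and> z * (1 - z) * G2 z + (c - (a + b + 1) * z) * G1 z - a * b * G z = 0"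
    and GB: "\<forall>z. 0 \<le> z \<and> z < 1 \<longrightarrow> 0 < G z \<and> G z \<le> B"
    using hypergeom_equation[OF abc] by blast
  have G: "(G has_real_derivative G1 z) (at z)" "(G1 has_real_derivative G2 z) (at z)" "isCont G2 z"
    "z * (1 - z) * G2 z + (c - (a + b + 1) * z) * G1 z - a * b * G z = 0" if "\<bar>z\<bar> < 1" for z
    using G0 that by blast+
  define f where "f = (\<lambda>z. (1 - z) powr s * G z)"
  define f1 where "f1 = (\<lambda>z. (1 - z) powr s * (G1 z - s * G z / (1 - z)))"
  define f2 where "f2 = (\<lambda>z. (1 - z) powr s *
      (G2 z - 2 * s * G1 z / (1 - z) + s * (s - 1) * G z / (1 - z)\<^sup>2))"
  \<comment> \<open>The factor \<open>(1 - z)\<^sup>s\<close>, common to \<open>f\<close> and its derivatives, cancels from the equation.\<close>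
  have P: "((\<lambda>z. (1 - z) powr s) has_real_derivative - s * (1 - z) powr s / (1 - z)) (at z)"
    if "\<bar>z\<bar> < 1" for z :: real
  proof -
    have "((\<lambda>z. (1 - z) powr s) has_real_derivative s * (1 - z) powr (s - 1) * (- 1)) (at z)"
      using that by (auto intro!: derivative_eq_intros)
    then show ?thesis using that by (simp add: powr_diff)
  qed
  have D1: "(f has_real_derivative f1 z) (at z)" if z: "\<bar>z\<bar> < 1" for z
    unfolding f_def
    by (rule DERIV_cong[OF DERIV_mult[OF P[OF z] G(1)[OF z]]]) (simp add: f1_def algebra_simps)
  have D2: "(f1 has_real_derivative f2 z) (at z)" if z: "\<bar>z\<bar> < 1" for z
  proof -
    have z1: "1 - z > 0" using z by simp
    have Q: "((\<lambda>z. G1 z - s * G z / (1 - z)) has_real_derivative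
        G2 z - (s * G1 z * (1 - z) + s * G z) / (1 - z)\<^sup>2) (at z)"
      using z1 by (auto intro!: derivative_eq_intros G(1)[OF z] G(2)[OF z] simp: power2_eq_square)
    have factor: "(- s * p / y) * X + Y * p = p * ((- s / y) * X + Y)" for p y X Y :: real
      by (simp add: algebra_simps)
    have "(- s * (1 - z) powr s / (1 - z)) * (G1 z - s * G z / (1 - z)) +
          (G2 z - (s * G1 z * (1 - z) + s * G z) / (1 - z)\<^sup>2) * (1 - z) powr s
        = (1 - z) powr s * ((- s / (1 - z)) * (G1 z - s * G z / (1 - z)) +
          (G2 z - (s * G1 z * (1 - z) + s * G z) / (1 - z)\<^sup>2))"
      by (rule factor)
    also have "(- s / (1 - z)) * (G1 z - s * G z / (1 - z)) +
          (G2 z - (s * G1 z * (1 - z) + s * G z) / (1 - z)\<^sup>2)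
        = G2 z - 2 * s * G1 z / (1 - z) + s * (s - 1) * G z / (1 - z)\<^sup>2"
      using z1 by (simp add: divide_simps power2_eq_square) (simp add: algebra_simps)
    finally have eq: "(- s * (1 - z) powr s / (1 - z)) * (G1 z - s * G z / (1 - z)) +
          (G2 z - (s * G1 z * (1 - z) + s * G z) / (1 - z)\<^sup>2) * (1 - z) powr s = f2 z"
      by (simp only: f2_def)
    show ?thesis
      unfolding f1_def by (rule DERIV_cong[OF DERIV_mult[OF P[OF z] Q] eq])
  qed
  have C2: "isCont f2 z" if z: "\<bar>z\<bar> < 1" for z
    unfolding f2_def using z
    by (intro continuous_intros G(3)[OF z] DERIV_isCont[OF G(2)[OF z]] DERIV_isCont[OF G(1)[OF z]]) auto
  have E: "(1 - z)\<^sup>2 * z * f2 z + ((1 - z)\<^sup>2 * N / 2 + (N - 2) * z * (1 - z)) * f1 z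
        = - (s * (N - 1 - s)) * f z" if z: "\<bar>z\<bar> < 1" for z
  proof -
    have "y\<^sup>2 * (1 - y) * (g2 - 2 * s * g1 / y + s * (s - 1) * g / y\<^sup>2)
        + (y\<^sup>2 * N / 2 + (N - 2) * (1 - y) * y) * (g1 - s * g / y) + s * (N - 1 - s) * g
        = y * ((1 - y) * y * g2 + (c - (a + b + 1) * (1 - y)) * g1 - a * b * g)"
      if "y \<noteq> 0" for y g g1 g2 :: real
      unfolding a_def b_def c_def using that
      by (simp add: divide_simps power2_eq_square) (simp add: algebra_simps)
    from this[of "1 - z" "G2 z" "G1 z" "G z"] z
    have "(1 - z)\<^sup>2 * z * (G2 z - 2 * s * G1 z / (1 - z) + s * (s - 1) * G z / (1 - z)\<^sup>2)
        + ((1 - z)\<^sup>2 * N / 2 + (N - 2) * z * (1 - z)) * (G1 z - s * G z / (1 - z))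
        + s * (N - 1 - s) * G z
        = (1 - z) * (z * (1 - z) * G2 z + (c - (a + b + 1) * z) * G1 z - a * b * G z)"
      by auto
    also have "\<dots> = 0" using G(4)[OF z] by simp
    finally have "(1 - z) powr s * ((1 - z)\<^sup>2 * z * (G2 z - 2 * s * G1 z / (1 - z) + s * (s - 1) * G z / (1 - z)\<^sup>2)
        + ((1 - z)\<^sup>2 * N / 2 + (N - 2) * z * (1 - z)) * (G1 z - s * G z / (1 - z))
        + s * (N - 1 - s) * G z) = 0" by simp
    moreover have "A * (p * X) + D * (p * Y) = - E * (p * g)" if "p * (A * X + D * Y + E * g) = 0"
      for p A X D Y E g :: real
      using that by (simp add: algebra_simps)
    ultimately show ?thesis unfolding f_def f1_def f2_def by blast
  qed
  show ?thesis
    by (intro exI[of _ f] exI[of _ f1] exI[of _ f2] exI[of _ B])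
      (use D1 D2 C2 E GB in \<open>auto simp: f_def mult.commute[of B] intro!: mult_left_mono\<close>)
qed

section \<open>Derivatives of radial functions\<close>

lemma power2_norm_has_derivative:
  "((\<lambda>y. (norm y)\<^sup>2) has_derivative (\<lambda>v. 2 * (x \<bullet> v))) (at (x::'a::real_inner))"
proof -
  have "((\<lambda>y. y \<bullet> y) has_derivative (\<lambda>v. x \<bullet> v + v \<bullet> x)) (at x)"
    by (intro has_derivative_inner has_derivative_ident)
  then show ?thesis by (simp add: power2_norm_eq_inner inner_commute)
qed

lemma radial_has_derivative:
  fixes x :: "'a::real_inner"
  assumes "(h has_real_derivative h') (at ((norm x)\<^sup>2))"
  shows "((\<lambda>y. h ((norm y)\<^sup>2)) has_derivative (\<lambda>v. 2 * (x \<bullet> v) * h')) (at x)"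
  using has_derivative_compose[OF power2_norm_has_derivative
      assms[unfolded has_field_derivative_def]]
  by (simp add: mult.commute)

text \<open>
  The derivative of \<open>y \<mapsto> y\<^sub>i h(\<bar>y\<bar>\<^sup>2)\<close>. Both the partial derivatives of a radial function and the
  components of its flux, whose divergence is the Laplacian, have this form.
\<close>
lemma coord_radial_has_derivative:
  fixes x :: "real^'n::finite"
  assumes "(h has_real_derivative h') (at ((norm x)\<^sup>2))"
  shows "((\<lambda>y. K * complex_of_real (y $ i * h ((norm y)\<^sup>2))) has_derivative
     (\<lambda>v. K * complex_of_real (v $ i * h ((norm x)\<^sup>2) + x $ i * (2 * (x \<bullet> v) * h')))) (at x)"
proof -
  have "((\<lambda>y. y $ i * h ((norm y)\<^sup>2)) has_derivative
     (\<lambda>v. x $ i * (2 * (x \<bullet> v) * h') + v $ i * h ((norm x)\<^sup>2))) (at x)"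
    by (intro has_derivative_mult radial_has_derivative[OF assms]
        bounded_linear.has_derivative[OF bounded_linear_vec_nth] has_derivative_ident)
  then have "((\<lambda>y. complex_of_real (y $ i * h ((norm y)\<^sup>2))) has_derivative
     (\<lambda>v. complex_of_real (x $ i * (2 * (x \<bullet> v) * h') + v $ i * h ((norm x)\<^sup>2)))) (at x)"
    by (rule has_derivative_of_real)
  then show ?thesis
    using has_derivative_mult_right by (fastforce simp: add.commute)
qed

text \<open>
  Partial derivatives only see the germ of a function, so formulas that hold on the open unit
  ball may be differentiated there although the functions are uncontrolled outside it.
\<close>
lemma partial_eqI:
  assumes "(g has_derivative D) (at x)" "open S" "x \<in> S" "\<And>y. y \<in> S \<Longrightarrow> f y = g y"
  shows "partial i f x = D (axis i 1)"
proof -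
  have "(f has_derivative D) (at x)"
    using assms has_derivative_transform_within_open[OF assms(1-3)] by simp
  then show ?thesis
    using frechet_derivative_at by (fastforce simp: partial_def)
qed

lemma C1_onI:
  assumes "open S" "\<And>y. y \<in> S \<Longrightarrow> f y = g y"
    and D: "\<And>x. x \<in> S \<Longrightarrow> (g has_derivative D x) (at x)"
    and cont: "\<And>i. continuous_on S (\<lambda>x. D x (axis i 1))"
  shows "C1_on S f"
  unfolding C1_on_def
proof (intro conjI allI)
  have "(f has_derivative D x) (at x)" if "x \<in> S" for x
    using has_derivative_transform_within_open[OF D[OF that] assms(1) that] assms(2) by simp
  then show "f differentiable_on S"
    by (meson differentiable_at_imp_differentiable_on differentiable_def)
  show "continuous_on S (partial i f)" for i
    using cont[of i] partial_eqI[OF D assms(1) _ assms(2)]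
    by (subst continuous_on_cong[OF refl, of _ _ "\<lambda>x. D x (axis i 1)"]) auto
qed

lemma inner_axis_1 [simp]: "(x::real^'n::finite) \<bullet> axis i 1 = x $ i"
  by (simp add: inner_axis)

section \<open>The Laplacian of a radial function on the Poincare ball\<close>

lemma norm_sq_less_1:
  assumes "x \<in> hyp_space" shows "\<bar>(norm x)\<^sup>2\<bar> < 1" "0 \<le> (norm x)\<^sup>2" "(norm x)\<^sup>2 < 1"
  using assms by (auto simp: hyp_space_def power_less_one_iff abs_square_less_1)

lemma open_hyp_space: "open hyp_space"
  by (simp add: hyp_space_def)

lemma continuous_on_radial:
  assumes "\<And>z::real. \<bar>z\<bar> < 1 \<Longrightarrow> isCont h z"
  shows "continuous_on hyp_space (\<lambda>x. h ((norm x)\<^sup>2))"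
proof (rule continuous_on_compose2[of "{z. \<bar>z\<bar> < 1}" h])
  show "continuous_on {z. \<bar>z\<bar> < 1} h"
    using assms by (auto intro: continuous_at_imp_continuous_on)
qed (auto intro!: continuous_intros dest: norm_sq_less_1(1))

lemma volume_density_hyp_metric:
  fixes x :: "real^'n::finite"
  assumes "x \<in> hyp_space"
  shows "volume_density hyp_metric x = (2 / (1 - (norm x)\<^sup>2)) ^ CARD('n)"
proof -
  have pos: "1 - (norm x)\<^sup>2 > 0" using norm_sq_less_1[OF assms] by simp
  have "det (hyp_metric x) = (4 / (1 - (norm x)\<^sup>2)\<^sup>2) ^ CARD('n)"
    by (simp add: hyp_metric_def det_diagonal mat_def)
  also have "4 / (1 - (norm x)\<^sup>2)\<^sup>2 = (2 / (1 - (norm x)\<^sup>2))\<^sup>2"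
    by (simp add: power_divide)
  also have "\<dots> ^ CARD('n) = ((2 / (1 - (norm x)\<^sup>2)) ^ CARD('n))\<^sup>2"
    by (simp add: power_mult[symmetric] mult.commute)
  finally show ?thesis
    using pos by (simp add: volume_density_def)
qed

lemma matrix_inv_hyp_metric:
  fixes x :: "real^'n::finite"
  assumes "x \<in> hyp_space"
  shows "matrix_inv (hyp_metric x) $ i $ j = (if i = j then (1 - (norm x)\<^sup>2)\<^sup>2 / 4 else 0)"
proof -
  have pos: "1 - (norm x)\<^sup>2 > 0" using norm_sq_less_1[OF assms] by simp
  define M where "M = ((1 - (norm x)\<^sup>2)\<^sup>2 / 4) *\<^sub>R (mat 1 :: real^'n^'n)"
  have 1: "hyp_metric x ** M = mat 1" "M ** hyp_metric x = mat 1"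
    using pos by (simp_all add: hyp_metric_def M_def scalar_matrix_assoc[symmetric] matrix_scalar_ac)
  then have "invertible (hyp_metric x)" by (auto simp: invertible_def)
  then have "matrix_inv (hyp_metric x) ** hyp_metric x = mat 1"
    by (simp add: invertible_def matrix_inv_def someI_ex[of "\<lambda>A'. hyp_metric x ** A' = mat 1 \<and> A' ** hyp_metric x = mat 1"])
  then have "matrix_inv (hyp_metric x) = M"
    using 1 by (metis matrix_mul_assoc matrix_mul_lid matrix_mul_rid)
  then show ?thesis by (simp add: M_def mat_def)
qed

text \<open>
  A profile that is twice continuously differentiable on \<open>(-1, 1)\<close>; the radial functions are its
  compositions with \<open>\<bar>x\<bar>\<^sup>2\<close>. The interval reaches below \<open>0\<close> so that the chain rule applies at
  the centre of the ball.
\<close>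

locale radial_profile =
  fixes f f1 f2 :: "real \<Rightarrow> real"
  assumes f_deriv: "\<And>z. \<bar>z\<bar> < 1 \<Longrightarrow> (f has_real_derivative f1 z) (at z)"
    and f1_deriv: "\<And>z. \<bar>z\<bar> < 1 \<Longrightarrow> (f1 has_real_derivative f2 z) (at z)"
    and f2_cont: "\<And>z. \<bar>z\<bar> < 1 \<Longrightarrow> isCont f2 z"
begin

text \<open>
  The complex factor \<open>K\<close> is part of the definition so that a radial function multiplied by a phase is
  again of this form.
\<close>

definition radial :: "complex \<Rightarrow> real^'n::finite \<Rightarrow> complex" where
  "radial K x = K * complex_of_real (f ((norm x)\<^sup>2))"

lemma has_derivative_radial:
  assumes "x \<in> hyp_space"
  shows "(radial K has_derivative (\<lambda>v. K * complex_of_real (2 * (x \<bullet> v) * f1 ((norm x)\<^sup>2)))) (at x)"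
  unfolding radial_def
  by (intro has_derivative_mult_right has_derivative_of_real radial_has_derivative f_deriv norm_sq_less_1 assms)

lemma partial_radial:
  assumes "x \<in> hyp_space"
  shows "partial i (radial K) x = 2 * K * complex_of_real (x $ i * f1 ((norm x)\<^sup>2))"
  using partial_eqI[OF has_derivative_radial[OF assms] open_hyp_space assms] by simp

lemma C2_on_radial: "C2_on hyp_space (radial K)"
  unfolding C2_on_def
proof (intro conjI allI)
  have c1: "isCont f z" "isCont f1 z" if "\<bar>z\<bar> < 1" for z
    using f_deriv f1_deriv that DERIV_isCont by blast+
  note cont = continuous_on_radial[OF c1(1)] continuous_on_radial[OF c1(2)] continuous_on_radial[OF f2_cont]
  show "C1_on hyp_space (radial K)"
    by (rule C1_onI[OF open_hyp_space refl has_derivative_radial])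
      (auto intro!: continuous_intros cont)
  show "C1_on hyp_space (partial i (radial K))" for i
    by (rule C1_onI[OF open_hyp_space partial_radial coord_radial_has_derivative[OF f1_deriv[OF norm_sq_less_1(1)]]])
      (auto intro!: continuous_intros cont)
qed

text \<open>
  The metric is conformal to the Euclidean one, so the flux of a radial function is
  \<open>y\<^sub>i h(\<bar>y\<bar>\<^sup>2)\<close> with \<open>h = w (1 - z)\<^sup>2 / 2 \<cdot> f'\<close>, where \<open>w\<close> is the volume density as a function of
  \<open>z = \<bar>y\<bar>\<^sup>2\<close>. Its divergence is \<open>N h + 2 z h'\<close>, which is then divided by \<open>w\<close>.
\<close>
lemma hyp_laplacian_radial:
  fixes x :: "real^'n::finite"
  assumes x: "x \<in> hyp_space"
  defines "z \<equiv> (norm x)\<^sup>2" and "N \<equiv> real CARD('n)"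
  shows "hyp_laplacian (radial K) x = K * complex_of_real
     ((1 - z)\<^sup>2 * z * f2 z + ((1 - z)\<^sup>2 * N / 2 + (N - 2) * z * (1 - z)) * f1 z)"
proof -
  let ?N = "CARD('n)"
  define w where "w = (\<lambda>z::real. (2 / (1 - z)) ^ ?N)"
  define h where "h = (\<lambda>z. w z * ((1 - z)\<^sup>2 / 2) * f1 z)"
  define h' where "h' = w z * ((N - 2) / 2 * (1 - z) * f1 z + (1 - z)\<^sup>2 / 2 * f2 z)"
  have z: "\<bar>z\<bar> < 1" "1 - z > 0" using norm_sq_less_1[OF x] by (auto simp: z_def)
  have wpos: "w z > 0" using z by (simp add: w_def)
  have w': "(w has_real_derivative N * w z / (1 - z)) (at z)"
  proof -
    have "(w has_real_derivative real ?N * (2 / (1 - z)) ^ (?N - 1) * (2 / (1 - z)\<^sup>2)) (at z)"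
      unfolding w_def using z by (auto intro!: derivative_eq_intros simp: power2_eq_square)
    moreover have "w z = (2 / (1 - z)) ^ (?N - 1) * (2 / (1 - z))"
      unfolding w_def by (rule power_minus_mult[symmetric]) simp
    ultimately show ?thesis
      by (simp add: N_def power2_eq_square mult.assoc)
  qed
  have q': "((\<lambda>z. (1 - z)\<^sup>2 / 2) has_real_derivative - (1 - z)) (at z)"
    by (auto intro!: derivative_eq_intros)
  have h: "(h has_real_derivative h') (at z)"
    unfolding h_def
  proof (rule DERIV_cong[OF DERIV_mult[OF DERIV_mult[OF w' q'] f1_deriv[OF z(1)]]])
    have "N * w z / (1 - z) * ((1 - z)\<^sup>2 / 2) = N * w z * (1 - z) / 2"
      using z by (simp add: power2_eq_square)
    then show "(N * w z / (1 - z) * ((1 - z)\<^sup>2 / 2) + - (1 - z) * w z) * f1 z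
        + f2 z * (w z * ((1 - z)\<^sup>2 / 2)) = h'"
      by (simp only: h'_def) (simp add: algebra_simps add_divide_distrib diff_divide_distrib)
  qed
  have flux: "volume_density hyp_metric y *\<^sub>R
        (\<Sum>j\<in>UNIV. (matrix_inv (hyp_metric y) $ i $ j) *\<^sub>R partial j (radial K) y)
      = K * complex_of_real (y $ i * h ((norm y)\<^sup>2))" if y: "y \<in> hyp_space" for y :: "real^'n" and i
  proof -
    have "(\<Sum>j\<in>UNIV. (matrix_inv (hyp_metric y) $ i $ j) *\<^sub>R partial j (radial K) y)
      = ((1 - (norm y)\<^sup>2)\<^sup>2 / 4) *\<^sub>R partial i (radial K) y"
      by (subst sum.remove[of _ i]) (auto simp: matrix_inv_hyp_metric[OF y])
    then show ?thesis
      by (simp add: volume_density_hyp_metric[OF y] partial_radial[OF y] h_def w_def scaleR_conv_of_real algebra_simps)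
  qed
  have "partial i (\<lambda>y. volume_density hyp_metric y *\<^sub>R
        (\<Sum>j\<in>UNIV. (matrix_inv (hyp_metric y) $ i $ j) *\<^sub>R partial j (radial K) y)) x
      = K * complex_of_real (h z + 2 * (x $ i)\<^sup>2 * h')" for i
    by (subst partial_eqI[OF coord_radial_has_derivative[OF h[unfolded z_def]] open_hyp_space x flux])
      (simp_all add: z_def power2_eq_square)
  then have "hyp_laplacian (radial K) x = (1 / w z) *\<^sub>R (\<Sum>i\<in>UNIV. K * complex_of_real (h z + 2 * (x $ i)\<^sup>2 * h'))"
    by (simp add: laplace_beltrami_def volume_density_hyp_metric[OF x] w_def z_def)
  also have "(\<Sum>i\<in>(UNIV::'n set). K * complex_of_real (h z + 2 * (x $ i)\<^sup>2 * h'))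
      = K * complex_of_real (\<Sum>i\<in>UNIV. h z + 2 * (x $ i)\<^sup>2 * h')"
    by (simp add: sum_distrib_left)
  also have "(\<Sum>i\<in>UNIV. h z + 2 * (x $ i)\<^sup>2 * h') = N * h z + 2 * z * h'"
  proof -
    have "(\<Sum>i\<in>UNIV. (x $ i)\<^sup>2) = z"
      unfolding z_def power2_norm_eq_inner by (simp add: inner_vec_def power2_eq_square)
    then show ?thesis
      by (simp add: sum.distrib sum_distrib_left[symmetric] sum_distrib_right[symmetric] N_def)
  qed
  also have "(1 / w z) *\<^sub>R (K * complex_of_real (N * h z + 2 * z * h'))
     = K * complex_of_real ((N * h z + 2 * z * h') / w z)"
    by (simp add: scaleR_conv_of_real)
  also have "(N * h z + 2 * z * h') / w z = (1 - z)\<^sup>2 * z * f2 z + ((1 - z)\<^sup>2 * N / 2 + (N - 2) * z * (1 - z)) * f1 z"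
    using wpos by (simp add: h_def h'_def divide_simps) (simp add: algebra_simps)
  finally show ?thesis .
qed

end

section \<open>Integrability at the boundary of the unit ball\<close>

text \<open>
  Bernoulli's inequality bounds \<open>1 - \<rho>\<^sup>n\<close> by \<open>n (1 - \<rho>)\<close>: the volume of a shell at the boundary of
  the unit ball is of the order of its thickness.
\<close>
lemma emeasure_annulus_le:
  assumes "0 \<le> \<rho>" "\<rho> \<le> 1"
  shows "emeasure lborel (ball 0 1 - ball 0 \<rho> :: 'a::euclidean_space set)
    \<le> ennreal (unit_ball_vol DIM('a) * DIM('a) * (1 - \<rho>))"
proof -
  let ?n = "DIM('a)"
  have "emeasure lborel (ball 0 1 - ball 0 \<rho> :: 'a set)
      = emeasure lborel (ball 0 1 :: 'a set) - emeasure lborel (ball 0 \<rho> :: 'a set)"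
    using assms by (intro emeasure_Diff) (auto simp: emeasure_ball)
  also have "\<dots> = ennreal (unit_ball_vol ?n - unit_ball_vol ?n * \<rho> ^ ?n)"
    using assms by (simp add: emeasure_ball ennreal_minus)
  also have "\<dots> \<le> ennreal (unit_ball_vol ?n * ?n * (1 - \<rho>))"
  proof (rule ennreal_leI)
    have "1 + real ?n * (\<rho> - 1) \<le> (1 + (\<rho> - 1)) ^ ?n"
      using assms by (intro Bernoulli_inequality) simp
    then have "unit_ball_vol ?n * (1 - \<rho> ^ ?n) \<le> unit_ball_vol ?n * (?n * (1 - \<rho>))"
      by (intro mult_left_mono) (simp_all add: algebra_simps)
    then show "unit_ball_vol ?n - unit_ball_vol ?n * \<rho> ^ ?n \<le> unit_ball_vol ?n * ?n * (1 - \<rho>)"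
      by (simp add: algebra_simps)
  qed
  finally show ?thesis .
qed

text \<open>
  Dyadic decomposition towards the unit sphere. Where \<open>1 - \<bar>x\<bar>\<close> is comparable to \<open>2\<^sup>-\<^sup>k\<close>, the integrand is
  at most of the order of \<open>2\<^sup>\<kappa>\<^sup>k\<close>, on a set of volume of the order of \<open>2\<^sup>-\<^sup>k\<close>; the resulting
  geometric series converges because \<open>\<kappa> < 1\<close>.
\<close>
lemma nn_integral_boundary_singularity_finite:
  fixes \<kappa> :: real
  assumes "\<kappa> < 1"
  shows "(\<integral>\<^sup>+x\<in>ball 0 1. ennreal ((1 - (norm x)\<^sup>2) powr - \<kappa>) \<partial>(lborel :: 'a::euclidean_space measure)) < \<infinity>"
proof -
  \<comment> \<open>With a nonnegative exponent the integrand increases towards the sphere.\<close>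
  define m where "m = max \<kappa> 0"
  have m: "0 \<le> m" "m < 1" "\<kappa> \<le> m" using assms by (auto simp: m_def)
  \<comment> \<open>The shells are nested, not disjoint: only an upper bound for the integrand is wanted.\<close>
  define A where "A = (\<lambda>k::nat. ball 0 1 - ball 0 (1 - (1/2) ^ k) :: 'a set)"
  define V where "V = unit_ball_vol DIM('a) * real DIM('a)"
  have V: "V \<ge> 0" by (simp add: V_def)
  have meas[measurable]: "A k \<in> sets lborel" for k by (simp add: A_def)
  have term_le_suminf: "g k \<le> (\<Sum>k. g k)" for g :: "nat \<Rightarrow> ennreal" and k
    using sum_le_suminf[of g "{k}"] by simp
  have pt: "ennreal ((1 - (norm x)\<^sup>2) powr - \<kappa>) * indicator (ball 0 1) x
      \<le> (\<Sum>k. ennreal (2 powr (m * real (k + 1))) * indicator (A k) x)" for x :: 'a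
  proof (cases "x \<in> ball 0 1")
    case True
    then have n1: "norm x < 1" by simp
    define d where "d = 1 - norm x"
    have d: "0 < d" "d \<le> 1" using n1 by (auto simp: d_def)
    \<comment> \<open>The thinnest of these shells that contains \<open>x\<close>.\<close>
    obtain k where k: "(1/2::real) ^ Suc k < d" "d \<le> (1/2) ^ k"
    proof -
      obtain n where "(1/2::real) ^ n < d" using real_arch_pow_inv[OF d(1), of "1/2"] by auto
      then have ex: "\<exists>n. (1/2::real) ^ n < d" ..
      define n0 where "n0 = (LEAST n. (1/2::real) ^ n < d)"
      have n0: "(1/2::real) ^ n0 < d" unfolding n0_def using ex by (rule LeastI_ex)
      have "n0 \<noteq> 0" using n0 d by (intro notI) simp
      then obtain k where "n0 = Suc k" by (cases n0) auto
      moreover have "\<not> (1/2::real) ^ k < d" using not_less_Least[of k "\<lambda>n. (1/2::real) ^ n < d"] \<open>n0 = Suc k\<close>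
        by (simp add: n0_def)
      ultimately show ?thesis using n0 that[of k] by simp
    qed
    have "d \<le> 1 - (norm x)\<^sup>2" using n1 by (simp add: d_def power2_eq_square mult_left_le)
    moreover have "1 - (norm x)\<^sup>2 \<le> 1" by simp
    ultimately have y: "d \<le> 1 - (norm x)\<^sup>2" "1 - (norm x)\<^sup>2 \<le> 1" by auto
    have "(1 - (norm x)\<^sup>2) powr - \<kappa> \<le> (1 - (norm x)\<^sup>2) powr - m"
      using y d m by (intro powr_mono') auto
    also have "\<dots> \<le> ((1/2) ^ Suc k) powr - m"
      using y d m k(1) by (intro powr_mono2') auto
    also have "(1/2::real) ^ Suc k = 2 powr - real (k + 1)"
      using powr_realpow[of 2 "k + 1"] by (simp only: powr_minus) (simp add: field_simps)
    also have "(2 powr - real (k + 1)) powr - m = 2 powr (m * real (k + 1))"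
      by (simp add: powr_powr algebra_simps)
    finally have "ennreal ((1 - (norm x)\<^sup>2) powr - \<kappa>) \<le> ennreal (2 powr (m * real (k + 1)))"
      by (rule ennreal_leI)
    also have "\<dots> = ennreal (2 powr (m * real (k + 1))) * indicator (A k) x"
      using True k(2) by (simp add: A_def d_def)
    also have "\<dots> \<le> (\<Sum>k. ennreal (2 powr (m * real (k + 1))) * indicator (A k) x)"
      by (rule term_le_suminf)
    finally show ?thesis using True by simp
  qed simp
  have geo: "2 powr (m * real (k + 1)) * (V * (1/2) ^ k) = V * 2 powr m * (2 powr (m - 1)) ^ k" for k
  proof -
    have "2 powr (m * real (k + 1)) = 2 powr m * (2 powr m) ^ k"
      using powr_realpow[of "2 powr m" k] by (simp add: powr_powr distrib_left powr_add)
    moreover have "(2 powr (m - 1)) ^ k = (2 powr m) ^ k * (1/2) ^ k"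
      by (simp add: powr_diff power_divide)
    ultimately show ?thesis by (simp add: algebra_simps)
  qed
  have "(\<integral>\<^sup>+x\<in>ball 0 1. ennreal ((1 - (norm x)\<^sup>2) powr - \<kappa>) \<partial>(lborel :: 'a measure))
      \<le> (\<integral>\<^sup>+x. (\<Sum>k. ennreal (2 powr (m * real (k + 1))) * indicator (A k) x) \<partial>lborel)"
    by (rule nn_integral_mono) (rule pt)
  also have "\<dots> = (\<Sum>k. \<integral>\<^sup>+x. ennreal (2 powr (m * real (k + 1))) * indicator (A k) x \<partial>lborel)"
    by (rule nn_integral_suminf) simp
  also have "\<dots> = (\<Sum>k. ennreal (2 powr (m * real (k + 1))) * emeasure lborel (A k))"
    by (subst nn_integral_cmult_indicator[OF meas]) (rule refl)
  also have "\<dots> \<le> (\<Sum>k. ennreal (V * 2 powr m * (2 powr (m - 1)) ^ k))"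
  proof (intro suminf_le summableI)
    fix k
    have "emeasure lborel (A k) \<le> ennreal (V * (1/2) ^ k)"
      using emeasure_annulus_le[where 'a='a, of "1 - (1/2) ^ k"] unfolding A_def V_def
      by (simp add: power_le_one)
    then have "ennreal (2 powr (m * real (k + 1))) * emeasure lborel (A k)
       \<le> ennreal (2 powr (m * real (k + 1))) * ennreal (V * (1/2) ^ k)"
      by (rule mult_left_mono) simp
    also have "\<dots> = ennreal (V * 2 powr m * (2 powr (m - 1)) ^ k)"
      using V by (subst geo[symmetric]) (simp add: ennreal_mult)
    finally show "ennreal (2 powr (m * real (k + 1))) * emeasure lborel (A k)
       \<le> ennreal (V * 2 powr m * (2 powr (m - 1)) ^ k)" .
  qed
  also have "\<dots> < \<infinity>"
  proof -
    have "2 powr (m - 1) < 2 powr 0" using m by (subst powr_less_cancel_iff) auto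
    then have "summable (\<lambda>k. V * 2 powr m * (2 powr (m - 1)) ^ k)"
      by (intro summable_mult summable_geometric) simp
    then show ?thesis
      using V by (subst suminf_ennreal2) auto
  qed
  finally show ?thesis .
qed

section \<open>Lebesgue norms for the hyperbolic volume\<close>

lemma borel_measurable_restrict_lborel:
  fixes f :: "real^'n::finite \<Rightarrow> 'b::topological_space"
  assumes "continuous_on hyp_space f"
  shows "f \<in> borel_measurable (restrict_space lborel hyp_space)"
  using borel_measurable_continuous_on_restrict[OF assms]
  by (simp add: measurable_def space_restrict_space sets_restrict_space)

lemma borel_measurable_volume_density:
  "(\<lambda>x. ennreal (volume_density hyp_metric x)) \<in>
     borel_measurable (restrict_space lborel (hyp_space :: (real^'n::finite) set))"
proof (rule measurable_compose[OF _ measurable_ennreal])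
  have "continuous_on hyp_space (\<lambda>x::real^'n. (2 / (1 - (norm x)\<^sup>2)) ^ CARD('n))"
    by (intro continuous_intros) (auto dest: norm_sq_less_1(3))
  then have "continuous_on hyp_space (volume_density (hyp_metric :: real^'n \<Rightarrow> _))"
    by (subst continuous_on_cong[OF refl volume_density_hyp_metric])
  then show "volume_density hyp_metric \<in> borel_measurable (restrict_space lborel (hyp_space :: (real^'n) set))"
    by (rule borel_measurable_restrict_lborel)
qed

lemma borel_measurable_hyp_volume:
  fixes f :: "real^'n::finite \<Rightarrow> 'b::topological_space"
  assumes "continuous_on hyp_space f"
  shows "f \<in> borel_measurable hyp_volume"
  using borel_measurable_restrict_lborel[OF assms]
  by (simp add: hyp_volume_def riemannian_volume_def)

lemma space_hyp_volume [simp]: "space hyp_volume = hyp_space"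
  by (simp add: hyp_volume_def riemannian_volume_def space_restrict_space)

lemma nn_integral_hyp_volume:
  fixes f :: "real^'n::finite \<Rightarrow> ennreal"
  assumes "f \<in> borel_measurable hyp_volume"
  shows "(\<integral>\<^sup>+x. f x \<partial>hyp_volume)
    = (\<integral>\<^sup>+x\<in>ball 0 1. ennreal ((2 / (1 - (norm x)\<^sup>2)) ^ CARD('n)) * f x \<partial>lborel)"
proof -
  have "f \<in> borel_measurable (restrict_space lborel hyp_space)"
    using assms by (simp add: hyp_volume_def riemannian_volume_def)
  then have "(\<integral>\<^sup>+x. f x \<partial>hyp_volume)
     = (\<integral>\<^sup>+x. ennreal (volume_density hyp_metric x) * f x \<partial>restrict_space lborel hyp_space)"
    unfolding hyp_volume_def riemannian_volume_def
    by (intro nn_integral_density borel_measurable_volume_density)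
  also have "\<dots> = (\<integral>\<^sup>+x\<in>ball 0 1. ennreal (volume_density hyp_metric x) * f x \<partial>lborel)"
    by (subst nn_integral_restrict_space) (auto simp: hyp_space_def)
  also have "\<dots> = (\<integral>\<^sup>+x\<in>ball 0 1. ennreal ((2 / (1 - (norm x)\<^sup>2)) ^ CARD('n)) * f x \<partial>lborel)"
    by (intro nn_integral_cong)
      (auto simp: indicator_def volume_density_hyp_metric hyp_space_def)
  finally show ?thesis .
qed

lemma not_AE_hyp_volume_False: "\<not> (AE x in (hyp_volume :: (real^'n::finite) measure). False)"
proof
  let ?D = "\<lambda>x::real^'n. ennreal ((2 / (1 - (norm x)\<^sup>2)) ^ CARD('n)) * indicator (ball 0 1) x"
  assume "AE x in (hyp_volume :: (real^'n) measure). False"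
  then have "(\<integral>\<^sup>+x. 1 \<partial>(hyp_volume :: (real^'n) measure)) = 0"
    by (subst nn_integral_0_iff_AE) auto
  then have "(\<integral>\<^sup>+x. ?D x \<partial>lborel) = 0"
    by (subst (asm) nn_integral_hyp_volume) simp_all
  moreover have "?D \<in> borel_measurable lborel"
    using borel_open[OF open_ball, measurable] by measurable
  ultimately have "AE x in lborel. ?D x = 0"
    by (simp only: nn_integral_0_iff_AE)
  then have "AE x in lborel. (x::real^'n) \<notin> ball 0 1"
  proof eventually_elim
    case (elim x)
    show ?case
    proof
      assume x: "x \<in> ball 0 1"
      then have "0 < (2 / (1 - (norm x)\<^sup>2)) ^ CARD('n)"
        using norm_sq_less_1(3)[of x] by (simp add: hyp_space_def)
      moreover have "(2 / (1 - (norm x)\<^sup>2)) ^ CARD('n) \<le> 0"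
        using elim x by (simp only: indicator_simps mult_1_right ennreal_eq_0_iff)
      ultimately show False by linarith
    qed
  qed
  then have "emeasure lborel (ball (0::real^'n) 1) = 0"
    by (subst (asm) AE_iff_measurable[of "ball 0 1"]) auto
  then show False
    by (simp add: emeasure_ball order_less_imp_not_eq2[OF unit_ball_vol_pos])
qed

text \<open>
  A vanishing norm means that \<open>f\<close> is zero almost everywhere, but here \<open>f\<close> is zero nowhere and the
  space is not a null set.
\<close>
lemma Lp_norm_hyp_volume_nonzero:
  fixes f :: "real^'n::finite \<Rightarrow> complex"
  assumes q: "1 \<le> q" and f: "f \<in> borel_measurable hyp_volume"
    and nz: "\<And>x. x \<in> hyp_space \<Longrightarrow> f x \<noteq> 0"
  shows "Lp_norm hyp_volume q f \<noteq> 0"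
proof
  assume 0: "Lp_norm hyp_volume q f = 0"
  have "AE x in hyp_volume. f x = 0"
  proof (cases "q = \<infinity>")
    case True
    then show ?thesis
      using 0 esssup_AE[of "\<lambda>x. ennreal (norm (f x))" hyp_volume] by (simp add: Lp_norm_def)
  next
    case False
    note [measurable] = f
    have I: "(\<integral>\<^sup>+x. ennreal (norm (f x) powr enn2real q) \<partial>hyp_volume) = 0"
      using 0 False by (auto simp: Lp_norm_def epowr_def enn2real_eq_0_iff split: if_splits)
    have "AE x in hyp_volume. ennreal (norm (f x) powr enn2real q) = 0"
      by (subst nn_integral_0_iff_AE[symmetric]) (use I in auto)
    then show ?thesis by eventually_elim (simp add: ennreal_eq_0_iff)
  qed
  moreover have "AE x in hyp_volume. x \<in> (hyp_space :: (real^'n) set)"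
    by (rule AE_I2) simp
  ultimately have "AE x in (hyp_volume :: (real^'n) measure). False"
    by eventually_elim (use nz in auto)
  then show False using not_AE_hyp_volume_False by blast
qed

text \<open>
  The density \<open>(2 / (1 - \<bar>x\<bar>\<^sup>2))\<^sup>N\<close> of the hyperbolic volume turns a bound by \<open>(1 - \<bar>x\<bar>\<^sup>2)\<^sup>s\<close> into the
  integrand \<open>(1 - \<bar>x\<bar>\<^sup>2)\<close> to the power \<open>s r - N\<close>, which is integrable over the ball once
  \<open>s r - N > -1\<close>. For \<open>r = \<infinity>\<close> the bound itself suffices, because \<open>s > 0\<close>.
\<close>
lemma in_Lp_hyp_volume:
  fixes u :: "real^'n::finite \<Rightarrow> complex"
  assumes r: "1 \<le> r" and cont: "continuous_on hyp_space u"
    and bound: "\<And>x. x \<in> hyp_space \<Longrightarrow> norm (u x) \<le> B * (1 - (norm x)\<^sup>2) powr s"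
    and s: "0 < s" "r \<noteq> \<infinity> \<Longrightarrow> real CARD('n) - 1 < s * enn2real r"
  shows "in_Lp hyp_volume r u"
  unfolding in_Lp_def
proof
  show meas[measurable]: "u \<in> borel_measurable hyp_volume"
    by (rule borel_measurable_hyp_volume[OF cont])
  have "0 \<le> norm (u 0)" by simp
  also have "norm (u 0) \<le> B" using bound[of 0] by (simp add: hyp_space_def)
  finally have B: "B \<ge> 0" .
  show "Lp_norm hyp_volume r u < \<infinity>"
  proof (cases "r = \<infinity>")
    case True
    have "AE x in hyp_volume. ennreal (norm (u x)) \<le> ennreal B"
    proof (rule AE_I2)
      fix x :: "real^'n" assume "x \<in> space hyp_volume"
      then have x: "x \<in> hyp_space" by simp
      have "(1 - (norm x)\<^sup>2) powr s \<le> 1"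
        using norm_sq_less_1[OF x] s by (intro powr_le1) auto
      then have "B * (1 - (norm x)\<^sup>2) powr s \<le> B" using B by (rule mult_left_le)
      then show "ennreal (norm (u x)) \<le> ennreal B"
        using bound[OF x] by (intro ennreal_leI) simp
    qed
    then have "esssup hyp_volume (\<lambda>x. ennreal (norm (u x))) \<le> ennreal B"
      by (intro esssup_I) auto
    then show ?thesis using True by (simp add: Lp_norm_def le_less_trans)
  next
    case False
    define R where "R = enn2real r"
    define N where "N = CARD('n)"
    have R: "R \<ge> 1" using r False enn2real_mono[of 1 r] by (simp add: R_def top.not_eq_extremum)
    define C where "C = 2 ^ N * B powr R"
    have C: "C \<ge> 0" by (simp add: C_def)
    have "(\<integral>\<^sup>+x. ennreal (norm (u x) powr R) \<partial>hyp_volume)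
       = (\<integral>\<^sup>+x\<in>ball 0 1. ennreal ((2 / (1 - (norm x)\<^sup>2)) ^ N) * ennreal (norm (u x) powr R) \<partial>lborel)"
      by (simp add: nn_integral_hyp_volume N_def)
    also have "\<dots> \<le> (\<integral>\<^sup>+x. ennreal C * (ennreal ((1 - (norm x)\<^sup>2) powr - (N - s * R)) * indicator (ball 0 1) x) \<partial>(lborel :: (real^'n) measure))"
    proof (rule nn_integral_mono)
      fix x :: "real^'n"
      show "ennreal ((2 / (1 - (norm x)\<^sup>2)) ^ N) * ennreal (norm (u x) powr R) * indicator (ball 0 1) x
        \<le> ennreal C * (ennreal ((1 - (norm x)\<^sup>2) powr - (N - s * R)) * indicator (ball 0 1) x)"
      proof (cases "x \<in> ball 0 1")
        case True
        then have x: "x \<in> hyp_space" by (simp add: hyp_space_def)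
        define y where "y = 1 - (norm x)\<^sup>2"
        have y: "y > 0" using norm_sq_less_1[OF x] by (simp add: y_def)
        have "(2 / y) ^ N * norm (u x) powr R \<le> (2 / y) ^ N * (B * y powr s) powr R"
          using bound[OF x] R y by (intro mult_left_mono powr_mono2) (auto simp: y_def)
        also have "\<dots> = C * y powr - (N - s * R)"
          using y B by (simp add: C_def powr_mult powr_powr power_divide powr_diff powr_realpow)
        finally show ?thesis using True C y
          by (simp add: y_def ennreal_mult[symmetric] ennreal_leI)
      qed simp
    qed
    also have "\<dots> = ennreal C * (\<integral>\<^sup>+x\<in>ball 0 1. ennreal ((1 - (norm x)\<^sup>2) powr - (N - s * R)) \<partial>(lborel :: (real^'n) measure))"
      using borel_open[OF open_ball, measurable] by (intro nn_integral_cmult) measurable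
    also have "\<dots> < \<infinity>"
      using nn_integral_boundary_singularity_finite[of "N - s * R", where 'a="real^'n"] s(2)[OF False]
      by (simp add: ennreal_mult_less_top N_def R_def)
    finally show ?thesis
      using False by (simp add: Lp_norm_def epowr_def R_def)
  qed
qed

section \<open>Standing waves\<close>

lemma Lp_norm_cmult_le:
  assumes u: "in_Lp M r u" and r: "1 \<le> r"
  shows "Lp_norm M r (\<lambda>x. c * u x) \<le> ennreal (norm c) * Lp_norm M r u"
proof -
  have meas[measurable]: "u \<in> borel_measurable M" and fin: "Lp_norm M r u < \<infinity>"
    using u by (auto simp: in_Lp_def)
  show ?thesis
  proof (cases "r = \<infinity>")
    case True
    have "AE x in M. ennreal (norm (c * u x)) \<le> ennreal (norm c) * esssup M (\<lambda>x. ennreal (norm (u x)))"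
      using esssup_AE[of "\<lambda>x. ennreal (norm (u x))" M]
      by eventually_elim (simp add: norm_mult ennreal_mult mult_left_mono)
    then show ?thesis
      using True by (auto simp: Lp_norm_def intro!: esssup_I)
  next
    case False
    define R where "R = enn2real r"
    have R: "R \<ge> 1" using r False enn2real_mono[of 1 r] by (simp add: R_def top.not_eq_extremum)
    define I where "I = (\<integral>\<^sup>+x. ennreal (norm (u x) powr R) \<partial>M)"
    have "I \<noteq> \<infinity>" using fin False by (auto simp: Lp_norm_def epowr_def I_def R_def split: if_splits)
    then obtain i where i: "I = ennreal i" "i \<ge> 0" by (cases I) auto
    have "(\<integral>\<^sup>+x. ennreal (norm (c * u x) powr R) \<partial>M) = ennreal (norm c powr R) * I"
      unfolding I_def by (simp add: norm_mult powr_mult ennreal_mult nn_integral_cmult)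
    also have "\<dots> = ennreal (norm c powr R * i)" using i by (simp add: ennreal_mult)
    finally have "Lp_norm M r (\<lambda>x. c * u x) = ennreal ((norm c powr R * i) powr (1 / R))"
      using False i by (simp add: Lp_norm_def epowr_def R_def)
    also have "(norm c powr R * i) powr (1 / R) = norm c * i powr (1 / R)"
      using i R by (simp add: powr_mult powr_powr)
    also have "ennreal \<dots> = ennreal (norm c) * Lp_norm M r u"
      using False i by (simp add: ennreal_mult Lp_norm_def epowr_def flip: R_def I_def)
    finally show ?thesis by simp
  qed
qed

text \<open>
  The difference of a standing wave at two times is \<open>u\<close> times the difference of the two phases, which
  is continuous in time.
\<close>
lemma continuous_in_Lp_standing_wave:
  assumes u: "in_Lp M r u" and r: "1 \<le> r"
  shows "continuous_in_Lp M r (\<lambda>t x. cis (a * t) * u x)"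
  unfolding continuous_in_Lp_def
proof (intro conjI allI)
  have meas[measurable]: "u \<in> borel_measurable M" and fin: "Lp_norm M r u < \<infinity>"
    using u by (auto simp: in_Lp_def)
  then obtain l where l: "Lp_norm M r u = ennreal l" "l \<ge> 0" by (cases "Lp_norm M r u") auto
  show "in_Lp M r (\<lambda>x. cis (a * t) * u x)" for t
    using Lp_norm_cmult_le[OF u r, of "cis (a * t)"] fin by (simp add: in_Lp_def le_less_trans)
  show "((\<lambda>s. Lp_norm M r (\<lambda>x. cis (a * s) * u x - cis (a * t) * u x)) \<longlongrightarrow> 0) (at t)" for t
  proof (rule tendsto_sandwich[where f = "\<lambda>_. 0"
        and h = "\<lambda>s. ennreal (norm (cis (a * s) - cis (a * t)) * l)"])
    have "isCont (\<lambda>s. norm (cis (a * s) - cis (a * t)) * l) t"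
      unfolding cis_conv_exp by (intro continuous_intros)
    then have "((\<lambda>s. norm (cis (a * s) - cis (a * t)) * l) \<longlongrightarrow> 0) (at t)"
      by (simp add: isCont_def)
    then show "((\<lambda>s. ennreal (norm (cis (a * s) - cis (a * t)) * l)) \<longlongrightarrow> 0) (at t)"
      using tendsto_ennrealI by fastforce
    show "\<forall>\<^sub>F s in at t. Lp_norm M r (\<lambda>x. cis (a * s) * u x - cis (a * t) * u x)
        \<le> ennreal (norm (cis (a * s) - cis (a * t)) * l)"
      using Lp_norm_cmult_le[OF u r, of "cis (a * s) - cis (a * t)" for s] l
      by (simp add: ennreal_mult algebra_simps)
  qed auto
qed

text \<open>
  The spatial norm of a standing wave does not depend on time, and a positive constant is not
  integrable over the real line.
\<close>
lemma mixed_norm_standing_wave: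
  assumes p: "p > 0" and nz: "Lp_norm M q u \<noteq> 0"
  shows "mixed_norm p q M (\<lambda>t x. cis (a * t) * u x) = \<infinity>"
proof -
  have "epowr (Lp_norm M q u) p \<noteq> 0"
    using nz p by (auto simp: epowr_def enn2real_eq_0_iff)
  moreover have "Lp_norm M q (\<lambda>x. cis (a * t) * u x) = Lp_norm M q u" for t
    by (simp add: Lp_norm_def norm_mult)
  ultimately show ?thesis
    by (simp add: mixed_norm_def epowr_def ennreal_mult_top)
qed

text \<open>
  Since \<open>\<i> \<cdot> \<partial>\<^sub>t\<close> multiplies \<open>exp (\<i> a t)\<close> by \<open>- a\<close>, the frequency has to be minus the eigenvalue. The
  hypotheses are stated for all multiples of \<open>u\<close> because the wave at time \<open>t\<close> is one of them.
\<close>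
lemma classical_solution_standing_wave:
  fixes u :: "real^'n::finite \<Rightarrow> complex"
  assumes C2: "\<And>K. C2_on hyp_space (\<lambda>x. K * u x)" and cont: "continuous_on hyp_space u"
    and ev: "\<And>K x. x \<in> hyp_space \<Longrightarrow> hyp_laplacian (\<lambda>x. K * u x) x = - complex_of_real a * (K * u x)"
  shows "classical_schroedinger_solution (\<lambda>t x. cis (a * t) * u x)"
proof -
  have D: "((\<lambda>s. cis (a * s) * u x) has_vector_derivative (\<i> * a * cis (a * t) * u x)) (at t)" for t x
  proof -
    have "((\<lambda>s. exp (\<i> * of_real (a * s)) * u x) has_vector_derivative (\<i> * a * exp (\<i> * of_real (a * t)) * u x)) (at t)"
      by (auto intro!: derivative_eq_intros has_vector_derivative_real_field)
    then show ?thesis by (simp add: cis_conv_exp)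
  qed
  have vd: "vector_derivative (\<lambda>s. cis (a * s) * u x) (at t) = \<i> * a * cis (a * t) * u x" for t x
    using D by (rule vector_derivative_at)
  show ?thesis
    unfolding classical_schroedinger_solution_def
  proof (intro conjI allI ballI)
    show "(\<lambda>t. cis (a * t) * u x) differentiable_on UNIV" for x
      using D by (auto simp: differentiable_on_def has_vector_derivative_def differentiable_def)
    have "continuous_on (UNIV \<times> hyp_space) (\<lambda>p. u (snd p))"
      by (rule continuous_on_compose2[OF cont]) (auto intro: continuous_intros)
    then show "continuous_on (UNIV \<times> hyp_space) (\<lambda>(t, x). vector_derivative (\<lambda>s. cis (a * s) * u x) (at t))"
      unfolding vd case_prod_beta by (intro continuous_intros)
  qed (simp_all add: C2 vd ev flip: mult.assoc)
qed

section \<open>Failure of the estimate for \<open>r > 2\<close>\<close>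

theorem theorem1p1:
  fixes p :: real and q r :: ennreal
  assumes "CARD('n::finite) \<ge> 2"
    and "1 \<le> p"
    and "1 \<le> q"
    and "1 \<le> r"
    and "strichartz_estimate TYPE('n) p q r"
  shows "1 \<le> r \<and> r \<le> 2"
proof (rule ccontr)
  assume "\<not> (1 \<le> r \<and> r \<le> 2)"
  with assms(4) have r2: "2 < r" by auto
  define N where "N = real CARD('n)"
  have N: "N \<ge> 2" using assms(1) by (simp add: N_def)
  have R2: "2 < enn2real r" if "r \<noteq> \<infinity>"
    using r2 that by (cases r) (auto simp: ennreal_less_iff simp flip: ennreal_numeral)
  \<comment> \<open>The decay rate \<open>s\<close> has to exceed \<open>lo\<close> for the eigenfunction to lie in \<open>L\<^sup>r\<close>. Because \<open>r > 2\<close>,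
    this leaves room below \<open>(N - 1) / 2\<close>, the upper limit for the decay rates of radial eigenfunctions.\<close>
  define lo where "lo = (if r = \<infinity> then 0 else (N - 1) / enn2real r)"
  have "lo < (N - 1) / 2"
  proof (cases "r = \<infinity>")
    case False
    have "(N - 1) / enn2real r < (N - 1) / 2"
      using N R2[OF False] by (intro divide_strict_left_mono) auto
    then show ?thesis using False by (simp add: lo_def)
  qed (use N in \<open>simp add: lo_def\<close>)
  then have "max lo (N / 2 - 1) < (N - 1) / 2" by (simp only: max_less_iff_conj) simp
  then obtain s where s: "max lo (N / 2 - 1) < s" "s < (N - 1) / 2"
    using dense by blast
  have s0: "s > 0" "N / 2 - 1 < s" using s N by auto
  have sr: "N - 1 < s * enn2real r" if "r \<noteq> \<infinity>"
    using s R2[OF that] that by (simp add: lo_def field_simps)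
  define a where "a = s * (N - 1 - s)"
  obtain f f1 f2 :: "real \<Rightarrow> real" and B where
    profile: "\<forall>z. \<bar>z\<bar> < 1 \<longrightarrow> (f has_real_derivative f1 z) (at z) \<and> (f1 has_real_derivative f2 z) (at z) \<and>
       isCont f2 z \<and>
       (1 - z)\<^sup>2 * z * f2 z + ((1 - z)\<^sup>2 * N / 2 + (N - 2) * z * (1 - z)) * f1 z
        = - (s * (N - 1 - s)) * f z"
    and fB: "\<forall>z. 0 \<le> z \<and> z < 1 \<longrightarrow> 0 < f z \<and> f z \<le> B * (1 - z) powr s"
    using radial_eigenprofile[of N s] s(2) s0 N by auto
  interpret radial_profile f f1 f2
    by unfold_locales (use profile in blast)+
  define u :: "real^'n \<Rightarrow> complex" where "u = radial 1"
  have radial_eq: "radial K = (\<lambda>x. K * u x)" for K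
    by (simp add: radial_def u_def fun_eq_iff)
  have cont: "continuous_on hyp_space u"
    using C2_on_radial[of 1] by (auto simp: u_def C2_on_def C1_on_def intro: differentiable_imp_continuous_on)
  have ev: "hyp_laplacian (\<lambda>x. K * u x) x = - complex_of_real a * (K * u x)" if "x \<in> hyp_space" for K x
  proof -
    have "hyp_laplacian (radial K) x = K * complex_of_real (- (s * (N - 1 - s)) * f ((norm x)\<^sup>2))"
      using hyp_laplacian_radial[OF that, of K] profile norm_sq_less_1(1)[OF that] by (simp only: N_def)
    also have "\<dots> = - complex_of_real a * (K * u x)"
      by (simp add: a_def u_def radial_def)
    finally show ?thesis by (simp only: radial_eq)
  qed
  have f_norm: "0 < f ((norm x)\<^sup>2)" "f ((norm x)\<^sup>2) \<le> B * (1 - (norm x)\<^sup>2) powr s"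
    if "x \<in> hyp_space" for x :: "real^'n"
    using fB norm_sq_less_1[OF that] by auto
  have uLr: "in_Lp hyp_volume r u"
    using f_norm sr
    by (intro in_Lp_hyp_volume[OF assms(4) cont _ s0(1)]) (auto simp: u_def radial_def N_def abs_of_pos)
  have unz: "Lp_norm hyp_volume q u \<noteq> 0"
    using f_norm by (intro Lp_norm_hyp_volume_nonzero assms(3) borel_measurable_hyp_volume cont)
      (fastforce simp: u_def radial_def)
  have sol: "schroedinger_ivp_solution r u (\<lambda>t x. cis (a * t) * u x)"
    unfolding schroedinger_ivp_solution_def
  proof (intro conjI)
    show "classical_schroedinger_solution (\<lambda>t x. cis (a * t) * u x)"
      using C2_on_radial ev cont
      by (intro classical_solution_standing_wave) (simp_all only: radial_eq[symmetric])
    show "continuous_in_Lp hyp_volume r (\<lambda>t x. cis (a * t) * u x)"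
      by (rule continuous_in_Lp_standing_wave[OF uLr assms(4)])
  qed simp
  obtain C :: real where
    "\<forall>(\<psi>\<^sub>0 :: real^'n \<Rightarrow> complex) \<psi>. in_Lp hyp_volume r \<psi>\<^sub>0 \<longrightarrow> schroedinger_ivp_solution r \<psi>\<^sub>0 \<psi> \<longrightarrow>
       mixed_norm p q hyp_volume \<psi> \<le> ennreal C * Lp_norm hyp_volume r \<psi>\<^sub>0"
    using assms(5) unfolding strichartz_estimate_def by blast
  then have "mixed_norm p q hyp_volume (\<lambda>t x. cis (a * t) * u x) \<le> ennreal C * Lp_norm hyp_volume r u"
    using uLr sol by blast
  also have "\<dots> < \<infinity>"
    using uLr by (simp add: in_Lp_def ennreal_mult_less_top)
  finally show False
    using mixed_norm_standing_wave[OF _ unz, of p a] assms(2) by simp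
qed

end
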